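(* The conditional sequential Rademacher complexity $$\mathfrak R_T(\mathcal F\mid x_1,\dots,x_t)=\sup_{\mathbf x}\mathbb E_{\epsilon_{t+1:T}}\sup_{f\in\mathcal F}\Big[2\sum_{s=t+1}^T\epsilon_s\,\ell\big(f,\mathbf x_{s-t}(\epsilon_{t+1:s-1})\big)-\sum_{s=1}^t\ell(f,x_s)\Big],\qquad 0\le t\le T,$$ where the supremum is over all $\mathcal X$-valued binary trees $\mathbf x$ of depth $T-t$, is an admissible relaxation.
   Context: $\mathcal F$ (learner's moves), $\mathcal X$ (Nature's moves) are sets, $\ell:\mathcal F\times\mathcal X\to\mathbb R$ is a loss, $T$ is the horizon, $\Delta(A)$ is the set of probability distributions on $A$. $\epsilon_{t+1},\dots,\epsilon_T$ are i.i.d. Rademacher (uniform $\pm1$) random variables. An $\mathcal X$-valued tree $\mathbf x$ of depth $d$ is a sequence $(\mathbf x_1,\dots,\mathbf x_d)$ of maps $\mathbf x_i:\{\pm1\}^{i-1}\to\mathcal X$. A relaxation is a sequence of functions $\mathbf{Rel}_T(\mathcal F\mid x_1,\dots,x_t)$, $0\le t\le T$. It is admissible if for all $x_1,\dots,x_T\in\mathcal X$, $$\mathbf{Rel}_T(\mathcal F\mid x_1,\dots,x_t)\ge\inf_{q\in\Delta(\mathcal F)}\sup_{x\in\mathcal X}\{\mathbb E_{f\sim q}\ell(f,x)+\mathbf{Rel}_T(\mathcal F\mid x_1,\dots,x_t,x)\}\quad(0\le t\le T-1)$$ and $\mathbf{Rel}_T(\mathcal F\mid x_1,\dots,x_T)\ge-\inf_{f\in\mathcal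 F}\sum_{t=1}^T\ell(f,x_t)$. Standing assumption: $\ell,\mathcal F,\mathcal X$ are such that all expectations are well defined and the minimax theorem in the space of distributions over $\mathcal F$ and $\mathcal X$ holds, i.e. for the functions $\Phi:\mathcal X\to\mathbb R$ of the future cost under consideration (here $\Phi(x)=\mathfrak R_T(\mathcal F\mid x_1,\dots,x_t,x)$), $\inf_{q\in\Delta(\mathcal F)}\sup_{x\in\mathcal X}\{\mathbb E_{f\sim q}\ell(f,x)+\Phi(x)\}=\sup_{p\in\Delta(\mathcal X)}\inf_{f\in\mathcal F}\mathbb E_{x\sim p}[\ell(f,x)+\Phi(x)]$. *)

theory Defs
  imports "HOL-Probability.Probability"
begin

(* The Lebesgue integral of a function with values in [-oo, oo], positive part minus negative part.
   It is meaningful for functions satisfying expectation_defined, and may then be infinite. *)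
definition expectation :: "'a measure \<Rightarrow> ('a \<Rightarrow> ereal) \<Rightarrow> ereal" where
  "expectation M g =
     enn2ereal (\<integral>\<^sup>+x. e2ennreal (g x) \<partial>M) - enn2ereal (\<integral>\<^sup>+x. e2ennreal (- g x) \<partial>M)"

definition expectation_defined :: "'a measure \<Rightarrow> ('a \<Rightarrow> ereal) \<Rightarrow> bool" where
  "expectation_defined M g \<longleftrightarrow>
     g \<in> borel_measurable M \<and>
     ((\<integral>\<^sup>+x. e2ennreal (g x) \<partial>M) < \<infinity> \<or> (\<integral>\<^sup>+x. e2ennreal (- g x) \<partial>M) < \<infinity>)"

lemma expectation_eq_integral:
  fixes g :: "'a \<Rightarrow> real"
  assumes "integrable M g"
  shows "expectation_defined M (\<lambda>x. ereal (g x))"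
    and "expectation M (\<lambda>x. ereal (g x)) = ereal (integral\<^sup>L M g)"
proof -
  have p: "(\<integral>\<^sup>+x. ennreal (g x) \<partial>M) < \<infinity>"
    using assms by (simp add: real_integrable_def less_top)
  have n: "(\<integral>\<^sup>+x. ennreal (- g x) \<partial>M) < \<infinity>"
    using assms by (simp add: real_integrable_def less_top)
  have e: "enn2ereal c = ereal (enn2real c)" if "c < \<infinity>" for c
    using that by (cases c) auto
  show "expectation_defined M (\<lambda>x. ereal (g x))"
    unfolding expectation_defined_def using p assms by auto
  show "expectation M (\<lambda>x. ereal (g x)) = ereal (integral\<^sup>L M g)"
    using e[OF p] e[OF n] by (simp add: expectation_def real_lebesgue_integral_def[OF assms])
qed

(* In what follows the move sets are the carriers of two measurable spaces F and X; the measures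
   carried by F and X themselves play no role. Delta(F) is space (prob_algebra F). A history
   x_1, ..., x_t is the list [x_1, ..., x_t]. *)

definition admissible ::
  "'f measure \<Rightarrow> 'x measure \<Rightarrow> ('f \<Rightarrow> 'x \<Rightarrow> real) \<Rightarrow> nat \<Rightarrow> ('x list \<Rightarrow> ereal) \<Rightarrow> bool" where
  "admissible F X loss T Rel \<longleftrightarrow>
     (\<forall>xs. set xs \<subseteq> space X \<longrightarrow> length xs < T \<longrightarrow>
        Rel xs \<ge> (INF q \<in> space (prob_algebra F). SUP x \<in> space X.
                     expectation q (\<lambda>f. ereal (loss f x)) + Rel (xs @ [x]))) \<and>
     (\<forall>xs. set xs \<subseteq> space X \<longrightarrow> length xs = T \<longrightarrow>
        Rel xs \<ge> - (INF f \<in> space F. ereal (\<Sum>x\<leftarrow>xs. loss f x)))"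

definition rademacher :: "real pmf" where
  "rademacher = pmf_of_set {-1, 1}"

definition sign_seqs :: "nat \<Rightarrow> real list set" where
  "sign_seqs n = {e. length e = n \<and> set e \<subseteq> {-1, 1}}"

(* The i-th level maps sign sequences of length i - 1 into A; values of a tree outside levels
   1..d, or at lists that are not such sign sequences, are irrelevant. *)
definition trees :: "nat \<Rightarrow> 'x set \<Rightarrow> (nat \<Rightarrow> real list \<Rightarrow> 'x) set" where
  "trees d A = {\<tau>. \<forall>i \<in> {1..d}. \<tau> i \<in> sign_seqs (i - 1) \<rightarrow> A}"

(* The list e holds the signs eps_{t+1}, ..., eps_T, so that eps_s = e ! (s - t - 1) and
   eps_{t+1:s-1} = take (s - t - 1) e. *)
definition cond_seq_rademacher ::
  "'f measure \<Rightarrow> 'x measure \<Rightarrow> ('f \<Rightarrow> 'x \<Rightarrow> real) \<Rightarrow> nat \<Rightarrow> 'x list \<Rightarrow> ereal" where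
  "cond_seq_rademacher F X loss T xs =
     (let t = length xs in
      SUP \<tau> \<in> trees (T - t) (space X).
        expectation (measure_pmf (replicate_pmf (T - t) rademacher))
          (\<lambda>e. SUP f \<in> space F.
             ereal (2 * (\<Sum>s = t + 1..T. e ! (s - t - 1) * loss f (\<tau> (s - t) (take (s - t - 1) e)))
                    - (\<Sum>s = 1..t. loss f (xs ! (s - 1))))))"

definition minimax_holds ::
  "'f measure \<Rightarrow> 'x measure \<Rightarrow> ('f \<Rightarrow> 'x \<Rightarrow> real) \<Rightarrow> ('x \<Rightarrow> ereal) \<Rightarrow> bool" where
  "minimax_holds F X loss \<Phi> \<longleftrightarrow>
     (INF q \<in> space (prob_algebra F). SUP x \<in> space X.
        expectation q (\<lambda>f. ereal (loss f x)) + \<Phi> x) =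
     (SUP p \<in> space (prob_algebra X). INF f \<in> space F.
        expectation p (\<lambda>x. ereal (loss f x) + \<Phi> x))"

(* xs is a history of length < T after which the future cost
   x \<mapsto> R_T(F | xs, x) is a real-valued function on X. *)
definition real_future_cost ::
  "'f measure \<Rightarrow> 'x measure \<Rightarrow> ('f \<Rightarrow> 'x \<Rightarrow> real) \<Rightarrow> nat \<Rightarrow> 'x list \<Rightarrow> bool" where
  "real_future_cost F X loss T xs \<longleftrightarrow>
     set xs \<subseteq> space X \<and> length xs < T \<and>
     (\<forall>x \<in> space X. \<bar>cond_seq_rademacher F X loss T (xs @ [x])\<bar> \<noteq> \<infinity>)"

end

theory Submission
  imports Defs
begin

text \<open>
  Choosing the maximising \<open>f\<close> separately for each sign sequence \<open>e\<close>, the conditional complexity is the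
  supremum over trees \<open>\<tau>\<close> and selections \<open>\<phi>\<close> of real numbers \<open>J H \<tau> \<phi>\<close>, where \<open>H\<close> is the loss on the
  history and \<open>J (H + K) \<tau> \<phi> = J H \<tau> \<phi> - E K (\<phi> e)\<close>. Splitting off the first level of a tree shows that,
  if the complexity is at most \<open>r\<close>, then \<open>J (H - 2 l\<^sub>x) \<tau>\<^sub>1 \<phi>\<^sub>1 + J (H + 2 l\<^sub>x) \<tau>\<^sub>2 \<phi>\<^sub>2 \<le> 2 r\<close> for all \<open>x\<close>,
  where \<open>l\<^sub>x f\<close> is the loss of \<open>f\<close> at \<open>x\<close>.
  Hence \<open>V = J (H + l\<^sub>x) \<tau>\<^sub>1 \<phi>\<^sub>1 + J (H - 2 l\<^sub>x) \<tau>\<^sub>2 \<phi>\<^sub>2 / 2\<close> is bounded by \<open>3 r / 2\<close>. If \<open>V\<close> is maximal up to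
  \<open>\<delta>\<close> at \<open>(x, \<tau>\<^sub>1, \<phi>\<^sub>1, \<tau>\<^sub>2, \<phi>\<^sub>2)\<close>, the learner plays \<open>\<phi>\<^sub>1 e\<close> for random signs \<open>e\<close>: comparing with \<open>V\<close> at
  \<open>(x', \<tau>', \<phi>', \<tau>\<^sub>1, \<phi>\<^sub>1)\<close> bounds expected loss plus future cost by \<open>r + \<delta>\<close> for every answer \<open>x'\<close>.
\<close>

section \<open>Expected suprema over finitely supported distributions\<close>

lemma expectation_mono_AE:
  assumes "AE x in M. g x \<le> h x"
  shows "expectation M g \<le> expectation M h"
proof -
  have "(\<integral>\<^sup>+x. e2ennreal (g x) \<partial>M) \<le> (\<integral>\<^sup>+x. e2ennreal (h x) \<partial>M)"
    using assms by (intro nn_integral_mono_AE) (auto elim!: eventually_mono intro: e2ennreal_mono)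
  moreover have "(\<integral>\<^sup>+x. e2ennreal (- h x) \<partial>M) \<le> (\<integral>\<^sup>+x. e2ennreal (- g x) \<partial>M)"
    using assms by (intro nn_integral_mono_AE) (auto elim!: eventually_mono intro: e2ennreal_mono)
  ultimately show ?thesis
    unfolding expectation_def by (intro ereal_minus_mono) (simp_all add: less_eq_ennreal.rep_eq)
qed

lemma expectation_distr:
  assumes [measurable]: "h \<in> M \<rightarrow>\<^sub>M N" "g \<in> borel_measurable N"
  shows "expectation (distr M N h) g = expectation M (\<lambda>x. g (h x))"
  by (simp add: expectation_def nn_integral_distr)

lemma expectation_pmf_finite:
  fixes g :: "'a \<Rightarrow> real"
  assumes "finite (set_pmf P)"
  shows "expectation (measure_pmf P) (\<lambda>e. ereal (g e)) = ereal (measure_pmf.expectation P g)"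
  using assms by (intro expectation_eq_integral integrable_measure_pmf_finite)

lemma selection_le_expectation_SUP:
  fixes g :: "'a \<Rightarrow> 'b \<Rightarrow> real"
  assumes "finite (set_pmf P)" "\<phi> \<in> UNIV \<rightarrow> A"
  shows "ereal (measure_pmf.expectation P (\<lambda>e. g e (\<phi> e)))
           \<le> expectation (measure_pmf P) (\<lambda>e. SUP f\<in>A. ereal (g e f))"
  unfolding expectation_pmf_finite[OF assms(1), symmetric]
  using assms(2) by (intro expectation_mono_AE AE_I2 SUP_upper) auto

text \<open>On a finite support near-maximisers can be picked point by point, at a cost of \<delta>
  in expectation. With the preceding lemma, supremum and expectation interchange.\<close>

lemma expectation_SUP_le_selections:
  fixes g :: "'a \<Rightarrow> 'b \<Rightarrow> real"
  assumes fin: "finite (set_pmf P)" and "A \<noteq> {}"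
    and le: "\<And>\<phi>. \<phi> \<in> UNIV \<rightarrow> A \<Longrightarrow> measure_pmf.expectation P (\<lambda>e. g e (\<phi> e)) \<le> b"
  shows "expectation (measure_pmf P) (\<lambda>e. SUP f\<in>A. ereal (g e f)) \<le> ereal b"
proof -
  note int = integrable_measure_pmf_finite[OF fin]
  obtain a where a: "a \<in> A" using \<open>A \<noteq> {}\<close> by blast
  \<comment> \<open>Changing the constant selection \<open>a\<close> at \<open>e\<close> alone
    alters the expectation by \<open>pmf P e * (g e f - g e a)\<close>. The weight is positive, so
    \<open>b\<close> limits \<open>g e f\<close>.\<close>
  have bdd: "bdd_above (g e ` A)" if e: "e \<in> set_pmf P" for e
  proof (rule bdd_aboveI2)
    fix f assume f: "f \<in> A"
    have pos: "pmf P e > 0" using e by (simp add: pmf_positive)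
    have "pmf P e * (g e f - g e a) = measure_pmf.expectation P (\<lambda>y. if y = e then g e f - g e a else 0)"
      using fin e by (subst integral_measure_pmf[of "set_pmf P"]) (auto simp: sum.delta if_distrib cong: if_cong)
    also have "\<dots> = measure_pmf.expectation P (\<lambda>y. g y (((\<lambda>_. a)(e := f)) y) - g y a)"
      by (intro Bochner_Integration.integral_cong) auto
    also have "\<dots> = measure_pmf.expectation P (\<lambda>y. g y (((\<lambda>_. a)(e := f)) y))
                    - measure_pmf.expectation P (\<lambda>y. g y a)"
      by (intro Bochner_Integration.integral_diff int)
    also have "\<dots> \<le> b - measure_pmf.expectation P (\<lambda>y. g y a)"
      using le[of "(\<lambda>_. a)(e := f)"] a f by auto
    finally show "g e f \<le> (b - measure_pmf.expectation P (\<lambda>y. g y a)) / pmf P e + g e a"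
      using pos by (simp add: field_simps)
  qed
  show ?thesis
  proof (rule ereal_le_epsilon2)
    fix \<delta> :: real assume "\<delta> > 0"
    define S where "S e = (SUP f\<in>A. g e f)" for e
    \<comment> \<open>By \<open>bdd\<close>, the real supremum \<open>S e\<close> is approached
      within \<delta> on the support; elsewhere any element of \<open>A\<close> will do.\<close>
    have "\<exists>f. f \<in> A \<and> (e \<in> set_pmf P \<longrightarrow> S e - \<delta> < g e f)" for e
    proof (cases "e \<in> set_pmf P")
      case True
      then show ?thesis
        using less_cSUP_iff[OF \<open>A \<noteq> {}\<close> bdd[OF True], of "S e - \<delta>"] \<open>\<delta> > 0\<close>
        by (auto simp: S_def)
    qed (use a in auto)
    then obtain \<phi> where \<phi>: "\<And>e. \<phi> e \<in> A" "\<And>e. e \<in> set_pmf P \<Longrightarrow> S e - \<delta> < g e (\<phi> e)"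
      by metis
    have "(SUP f\<in>A. ereal (g e f)) \<le> ereal (g e (\<phi> e) + \<delta>)" if "e \<in> set_pmf P" for e
    proof (rule SUP_least)
      fix f assume "f \<in> A"
      then have "g e f \<le> S e" unfolding S_def by (intro cSUP_upper bdd that)
      then show "ereal (g e f) \<le> ereal (g e (\<phi> e) + \<delta>)" using \<phi>(2)[OF that] by simp
    qed
    then have "expectation (measure_pmf P) (\<lambda>e. SUP f\<in>A. ereal (g e f))
                 \<le> expectation (measure_pmf P) (\<lambda>e. ereal (g e (\<phi> e) + \<delta>))"
      by (intro expectation_mono_AE) (simp add: AE_measure_pmf_iff)
    also have "\<dots> = ereal (measure_pmf.expectation P (\<lambda>e. g e (\<phi> e)) + \<delta>)"
      by (simp add: expectation_pmf_finite[OF fin] int)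
    also have "\<dots> \<le> ereal b + ereal \<delta>"
      using le[of \<phi>] \<phi>(1) by auto
    finally show "expectation (measure_pmf P) (\<lambda>e. SUP f\<in>A. ereal (g e f)) \<le> ereal b + ereal \<delta>" .
  qed
qed

section \<open>Random signs, payoffs and splitting a tree at its root\<close>

lemma set_pmf_rademacher [simp]: "set_pmf rademacher = {-1, 1}"
  by (simp add: rademacher_def)

lemma set_pmf_replicate_rademacher: "set_pmf (replicate_pmf d rademacher) = sign_seqs d"
  by (auto simp: set_replicate_pmf sign_seqs_def)

lemma finite_set_pmf_replicate_rademacher [simp]:
  "finite (set_pmf (replicate_pmf d rademacher))"
  unfolding set_pmf_replicate_rademacher sign_seqs_def
  using finite_lists_length_eq[of "{-1, 1 :: real}" d] by (simp add: conj_commute)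

lemma integral_replicate_rademacher_Suc:
  fixes g :: "real list \<Rightarrow> real"
  shows "measure_pmf.expectation (replicate_pmf (Suc d) rademacher) g =
     (measure_pmf.expectation (replicate_pmf d rademacher) (\<lambda>e. g (1 # e))
      + measure_pmf.expectation (replicate_pmf d rademacher) (\<lambda>e. g (-1 # e))) / 2"
proof -
  have pmf: "pmf rademacher 1 = 1 / 2" "pmf rademacher (-1) = 1 / 2"
    by (simp_all add: rademacher_def)
  show ?thesis
    by (simp add: map_pmf_def[symmetric] pmf_expectation_bind[of "{-1, 1}"] pmf field_simps)
qed

text \<open>This is \<open>J H \<tau> \<phi>\<close> of the overview. \<open>H\<close> is left free
  so that the root term of a tree can be absorbed in it; \<phi> sees all signs, as the inner
  supremum does.\<close>

definition payoff ::
  "('f \<Rightarrow> 'x \<Rightarrow> real) \<Rightarrow> nat \<Rightarrow> ('f \<Rightarrow> real) \<Rightarrow> (nat \<Rightarrow> real list \<Rightarrow> 'x) \<Rightarrow> (real list \<Rightarrow> 'f) \<Rightarrow> real" where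
  "payoff l d H \<tau> \<phi> = measure_pmf.expectation (replicate_pmf d rademacher)
     (\<lambda>e. 2 * (\<Sum>i<d. e ! i * l (\<phi> e) (\<tau> (Suc i) (take i e))) - H (\<phi> e))"

lemma payoff_shift:
  "payoff l d (\<lambda>f. H f + K f) \<tau> \<phi>
     = payoff l d H \<tau> \<phi> - measure_pmf.expectation (replicate_pmf d rademacher) (\<lambda>e. K (\<phi> e))"
  unfolding payoff_def
  by (subst Bochner_Integration.integral_diff[symmetric])
     (auto intro!: integrable_measure_pmf_finite simp: algebra_simps)

definition join_tree :: "'x \<Rightarrow> (nat \<Rightarrow> real list \<Rightarrow> 'x) \<Rightarrow> (nat \<Rightarrow> real list \<Rightarrow> 'x) \<Rightarrow> nat \<Rightarrow> real list \<Rightarrow> 'x" where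
  "join_tree x \<tau>p \<tau>m i e = (case e of [] \<Rightarrow> x | b # e' \<Rightarrow> (if b = 1 then \<tau>p else \<tau>m) (i - 1) e')"

lemma join_tree_in_trees:
  assumes "x \<in> A" "\<tau>p \<in> trees d A" "\<tau>m \<in> trees d A"
  shows "join_tree x \<tau>p \<tau>m \<in> trees (Suc d) A"
  unfolding trees_def
proof (clarsimp)
  fix i e assume i: "Suc 0 \<le> i" "i \<le> Suc d" and e: "e \<in> sign_seqs (i - Suc 0)"
  show "join_tree x \<tau>p \<tau>m i e \<in> A"
  proof (cases e)
    case Nil
    then show ?thesis using assms by (simp add: join_tree_def)
  next
    case (Cons b e')
    then have "e' \<in> sign_seqs (i - 1 - 1)" "i - 1 \<in> {1..d}"
      using e i by (auto simp: sign_seqs_def)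
    then show ?thesis using assms Cons by (auto simp: join_tree_def trees_def Pi_iff)
  qed
qed

text \<open>Condition on the first sign: the root adds \<open>2 * l f x\<close> or its negative,
  which goes into \<open>H\<close> with the opposite sign. Writing \<open>+ (- 2) * l f x\<close>
  fits the form of \<open>payoff_shift\<close>.\<close>

lemma payoff_join:
  "payoff l (Suc d) H (join_tree x \<tau>p \<tau>m) (\<lambda>e. if hd e = 1 then \<phi>p (tl e) else \<phi>m (tl e)) =
     (payoff l d (\<lambda>f. H f + (- 2) * l f x) \<tau>p \<phi>p + payoff l d (\<lambda>f. H f + 2 * l f x) \<tau>m \<phi>m) / 2"
  unfolding payoff_def integral_replicate_rademacher_Suc
  by (simp add: sum.lessThan_Suc_shift join_tree_def algebra_simps del: sum.lessThan_Suc)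

section \<open>The learner's strategy\<close>

lemma trees_nonempty: "x \<in> A \<Longrightarrow> (\<lambda>_ _. x) \<in> trees d A"
  by (auto simp: trees_def)

text \<open>\<phi> encodes a mixed move: play \<open>\<phi> e\<close> for random signs
  \<open>e\<close>. The bound is uniform in \<open>\<tau>'\<close> and \<open>\<phi>'\<close>, so it
  survives the suprema in the future cost.\<close>

lemma near_optimal_strategy:
  fixes l :: "'f \<Rightarrow> 'x \<Rightarrow> real"
  assumes "A \<noteq> {}" "B \<noteq> {}" "\<delta> > 0"
    and bound: "\<And>\<tau> \<phi>. \<tau> \<in> trees (Suc d) A \<Longrightarrow> \<phi> \<in> UNIV \<rightarrow> B \<Longrightarrow> payoff l (Suc d) H \<tau> \<phi> \<le> r"
  shows "\<exists>\<phi>\<in>UNIV \<rightarrow> B. \<forall>x'\<in>A. \<forall>\<tau>'\<in>trees d A. \<forall>\<phi>'\<in>UNIV \<rightarrow> B.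
    measure_pmf.expectation (replicate_pmf d rademacher) (\<lambda>e. l (\<phi> e) x')
      + payoff l d (\<lambda>f. H f + l f x') \<tau>' \<phi>' \<le> r + \<delta>"
proof -
  define E where "E \<phi> x = measure_pmf.expectation (replicate_pmf d rademacher) (\<lambda>e. l (\<phi> e) x)" for \<phi> x
  define J where "J = payoff l d H"
  have shift: "payoff l d (\<lambda>f. H f + l f x) \<tau> \<phi> = J \<tau> \<phi> - E \<phi> x" for x \<tau> \<phi>
    by (simp add: payoff_shift J_def E_def)
  have pair: "J \<tau>1 \<phi>1 + 2 * E \<phi>1 x + (J \<tau>2 \<phi>2 - 2 * E \<phi>2 x) \<le> 2 * r"
    if "x \<in> A" "\<tau>1 \<in> trees d A" "\<tau>2 \<in> trees d A" "\<phi>1 \<in> UNIV \<rightarrow> B" "\<phi>2 \<in> UNIV \<rightarrow> B"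
    for x \<tau>1 \<tau>2 \<phi>1 \<phi>2
  proof -
    have "payoff l (Suc d) H (join_tree x \<tau>1 \<tau>2) (\<lambda>e. if hd e = 1 then \<phi>1 (tl e) else \<phi>2 (tl e)) \<le> r"
      using that by (intro bound join_tree_in_trees) (auto simp: Pi_iff)
    then show ?thesis
      unfolding payoff_join payoff_shift by (simp add: J_def E_def)
  qed
  \<comment> \<open>In the second slot, \<open>(\<tau>1, \<phi>1)\<close> contributes
    \<open>J \<tau>1 \<phi>1 / 2 + E \<phi>1 x'\<close>: the learner's expected loss, plus half of a
    term that it has in the first slot. This dictates the factor 1/2.\<close>
  define V where "V = (\<lambda>(x, \<tau>1, \<phi>1 :: real list \<Rightarrow> 'f, \<tau>2, \<phi>2 :: real list \<Rightarrow> 'f). J \<tau>1 \<phi>1 - E \<phi>1 x + (J \<tau>2 \<phi>2 + 2 * E \<phi>2 x) / 2)"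
  define D where "D = (A \<times> trees d A \<times> (UNIV \<rightarrow> B) \<times> trees d A \<times> (UNIV \<rightarrow> B)
    :: ('x \<times> _ \<times> (real list \<Rightarrow> 'f) \<times> _ \<times> (real list \<Rightarrow> 'f)) set)"
  obtain a b where "a \<in> A" "b \<in> B" using assms by blast
  then have "(a, \<lambda>_ _. a, \<lambda>_. b, \<lambda>_ _. a, \<lambda>_. b) \<in> D"
    by (auto simp: D_def trees_nonempty)
  then have D: "D \<noteq> {}" by blast
  have bdd: "bdd_above (V ` D)"
  proof (rule bdd_aboveI2)
    fix z assume "z \<in> D"
    then obtain x \<tau>1 \<phi>1 \<tau>2 \<phi>2 where z: "z = (x, \<tau>1, \<phi>1, \<tau>2, \<phi>2)"
      and *: "x \<in> A" "\<tau>1 \<in> trees d A" "\<tau>2 \<in> trees d A" "\<phi>1 \<in> UNIV \<rightarrow> B" "\<phi>2 \<in> UNIV \<rightarrow> B"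
      by (auto simp: D_def)
    \<comment> \<open>Swapping the copies and halving gives
      \<open>V z - J \<tau>1 \<phi>1 / 2 \<le> r\<close>; with twin copies the \<open>E\<close>
      terms cancel, giving \<open>J \<tau>1 \<phi>1 \<le> r\<close>.\<close>
    from pair[OF *(1,3,2,5,4)] pair[OF *(1,2,2,4,4)] show "V z \<le> 3 / 2 * r"
      by (simp add: V_def z field_simps)
  qed
  have "\<exists>z\<in>D. (SUP z\<in>D. V z) - \<delta> < V z"
    using less_cSUP_iff[OF D bdd, of "(SUP z\<in>D. V z) - \<delta>"] \<open>\<delta> > 0\<close> by simp
  then obtain x \<tau>1 \<phi>1 \<tau>2 \<phi>2 where
    *: "x \<in> A" "\<tau>1 \<in> trees d A" "\<tau>2 \<in> trees d A" "\<phi>1 \<in> UNIV \<rightarrow> B" "\<phi>2 \<in> UNIV \<rightarrow> B"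
    and near: "(SUP z\<in>D. V z) - \<delta> < V (x, \<tau>1, \<phi>1, \<tau>2, \<phi>2)"
    by (auto simp: D_def)
  show ?thesis
  proof (intro bexI[OF _ *(4)] ballI)
    fix x' \<tau>' and \<phi>' :: "real list \<Rightarrow> 'f"
    assume "x' \<in> A" "\<tau>' \<in> trees d A" "\<phi>' \<in> UNIV \<rightarrow> B"
    then have "V (x', \<tau>', \<phi>', \<tau>1, \<phi>1) \<le> (SUP z\<in>D. V z)"
      using * by (intro cSUP_upper bdd) (auto simp: D_def)
    with near have "V (x', \<tau>', \<phi>', \<tau>1, \<phi>1) < V (x, \<tau>1, \<phi>1, \<tau>2, \<phi>2) + \<delta>" by simp
    \<comment> \<open>Once \<open>J \<tau>1 \<phi>1 / 2\<close> cancels, the right side is \<delta>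
      plus half the left side of \<open>pair\<close> with the copies swapped.\<close>
    then have "E \<phi>1 x' + (J \<tau>' \<phi>' - E \<phi>' x') \<le> r + \<delta>"
      using pair[OF *(1,3,2,5,4)] by (simp add: V_def field_simps)
    then show "measure_pmf.expectation (replicate_pmf d rademacher) (\<lambda>e. l (\<phi>1 e) x')
         + payoff l d (\<lambda>f. H f + l f x') \<tau>' \<phi>' \<le> r + \<delta>"
      unfolding shift E_def .
  qed
qed

section \<open>The complexity as a supremum of payoffs, and admissibility\<close>

lemma cond_seq_rademacher_altdef:
  "cond_seq_rademacher F X loss T xs =
    (SUP \<tau>\<in>trees (T - length xs) (space X).
       expectation (measure_pmf (replicate_pmf (T - length xs) rademacher))
         (\<lambda>e. SUP f\<in>space F. ereal (2 * (\<Sum>i<T - length xs. e ! i * loss f (\<tau> (Suc i) (take i e)))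
                                      - (\<Sum>x\<leftarrow>xs. loss f x))))"
proof -
  have "(\<Sum>s = length xs + 1..T. g (s - length xs - 1) (s - length xs)) = (\<Sum>i<T - length xs. g i (Suc i))"
    for g :: "nat \<Rightarrow> nat \<Rightarrow> real"
    by (rule sum.reindex_bij_witness[where i="\<lambda>i. length xs + 1 + i" and j="\<lambda>s. s - length xs - 1"])
       (auto simp: Suc_diff_Suc)
  then have "(\<Sum>s = length xs + 1..T. e ! (s - length xs - 1) * loss f (\<tau> (s - length xs) (take (s - length xs - 1) e)))
      = (\<Sum>i<T - length xs. e ! i * loss f (\<tau> (Suc i) (take i e)))" for e f \<tau>
    .
  moreover have "(\<Sum>s = 1..length xs. loss f (xs ! (s - 1))) = (\<Sum>x\<leftarrow>xs. loss f x)" for f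
    by (subst sum_list_sum_nth, rule sum.reindex_bij_witness[where i="Suc" and j="\<lambda>s. s - 1"]) auto
  ultimately show ?thesis
    unfolding cond_seq_rademacher_def Let_def by (simp only:)
qed

lemma payoff_le_cond_seq_rademacher:
  assumes "\<tau> \<in> trees (T - length xs) (space X)" "\<phi> \<in> UNIV \<rightarrow> space F"
  shows "ereal (payoff loss (T - length xs) (\<lambda>f. \<Sum>x\<leftarrow>xs. loss f x) \<tau> \<phi>)
           \<le> cond_seq_rademacher F X loss T xs"
  unfolding cond_seq_rademacher_altdef payoff_def
  by (rule SUP_upper2[OF assms(1)], rule selection_le_expectation_SUP) (use assms in auto)

lemma cond_seq_rademacher_le:
  assumes "space F \<noteq> {}"
    and "\<And>\<tau> \<phi>. \<tau> \<in> trees (T - length xs) (space X) \<Longrightarrow> \<phi> \<in> UNIV \<rightarrow> space F \<Longrightarrow>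
      payoff loss (T - length xs) (\<lambda>f. \<Sum>x\<leftarrow>xs. loss f x) \<tau> \<phi> \<le> b"
  shows "cond_seq_rademacher F X loss T xs \<le> ereal b"
  unfolding cond_seq_rademacher_altdef
  by (rule SUP_least, rule expectation_SUP_le_selections) (use assms in \<open>auto simp: payoff_def\<close>)

theorem proposition2:
  fixes F :: "'f measure" and X :: "'x measure"
    and loss :: "'f \<Rightarrow> 'x \<Rightarrow> real" and T :: nat
  assumes F_nonempty: "space F \<noteq> {}"
    and learner_expectations:
      "\<And>q x. q \<in> space (prob_algebra F) \<Longrightarrow> x \<in> space X \<Longrightarrow>
         expectation_defined q (\<lambda>f. ereal (loss f x))"
    and nature_expectations:
      "\<And>xs p f. real_future_cost F X loss T xs \<Longrightarrow> p \<in> space (prob_algebra X) \<Longrightarrow> f \<in> space F \<Longrightarrow>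
         expectation_defined p (\<lambda>x. ereal (loss f x) + cond_seq_rademacher F X loss T (xs @ [x]))"
    and minimax:
      "\<And>xs. real_future_cost F X loss T xs \<Longrightarrow>
         minimax_holds F X loss (\<lambda>x. cond_seq_rademacher F X loss T (xs @ [x]))"
  shows "admissible F X loss T (cond_seq_rademacher F X loss T)"
  unfolding admissible_def
proof (intro conjI allI impI)
  let ?R = "cond_seq_rademacher F X loss T"
  fix xs assume "set xs \<subseteq> space X" and len: "length xs < T"
  define W where "W q = (SUP x\<in>space X. expectation q (\<lambda>f. ereal (loss f x)) + ?R (xs @ [x]))" for q
  define d where "d = T - Suc (length xs)"
  have d: "T - length xs = Suc d" using len by (simp add: d_def)
  have "(INF q\<in>space (prob_algebra F). W q) \<le> ?R xs"
  proof (cases "space X = {}")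
    case True
    \<comment> \<open>The supremum over no answers is -oo, so any move works, for instance a point
      mass.\<close>
    obtain f where "f \<in> space F" using F_nonempty by blast
    then have "return F f \<in> space (prob_algebra F)"
      by (simp add: space_prob_algebra prob_space_return)
    then have "(INF q\<in>space (prob_algebra F). W q) \<le> W (return F f)"
      by (rule INF_lower)
    also have "W (return F f) = - \<infinity>"
      by (simp add: W_def True bot_ereal_def)
    finally show ?thesis by simp
  next
    case False
    show ?thesis
    \<comment> \<open>Working with real upper bounds \<open>r\<close> covers infinite values of the
      complexity too.\<close>
    proof (rule ereal_le_real)
      fix r assume r: "?R xs \<le> ereal r"
      have bound: "payoff loss (Suc d) (\<lambda>f. \<Sum>x\<leftarrow>xs. loss f x) \<tau> \<phi> \<le> r"
        if "\<tau> \<in> trees (Suc d) (space X)" "\<phi> \<in> UNIV \<rightarrow> space F" for \<tau> \<phi>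
        using order_trans[OF payoff_le_cond_seq_rademacher[of \<tau> T xs X \<phi> F loss] r] that len d by simp
      show "(INF q\<in>space (prob_algebra F). W q) \<le> ereal r"
      proof (rule ereal_le_epsilon2)
        fix \<delta> :: real assume "\<delta> > 0"
        let ?P = "replicate_pmf d rademacher"
        obtain \<phi> where \<phi>: "\<phi> \<in> UNIV \<rightarrow> space F"
          and \<phi>_le: "\<And>x' \<tau>' \<phi>'. x' \<in> space X \<Longrightarrow> \<tau>' \<in> trees d (space X) \<Longrightarrow> \<phi>' \<in> UNIV \<rightarrow> space F \<Longrightarrow>
            measure_pmf.expectation ?P (\<lambda>e. loss (\<phi> e) x')
              + payoff loss d (\<lambda>f. (\<Sum>x\<leftarrow>xs. loss f x) + loss f x') \<tau>' \<phi>' \<le> r + \<delta>"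
          using near_optimal_strategy[OF False F_nonempty \<open>\<delta> > 0\<close> bound] by blast
        \<comment> \<open>The sign space carries the discrete sigma-algebra.\<close>
        have \<phi>_measurable: "\<phi> \<in> measure_pmf ?P \<rightarrow>\<^sub>M F"
          using \<phi> by auto
        define q where "q = distr (measure_pmf ?P) F \<phi>"
        have q: "q \<in> space (prob_algebra F)"
          using measure_pmf.prob_space_distr[OF \<phi>_measurable]
          by (simp add: q_def space_prob_algebra)
        have "W q \<le> ereal (r + \<delta>)"
          unfolding W_def
        proof (rule SUP_least)
          fix x assume x: "x \<in> space X"
          \<comment> \<open>\<open>q\<close> has the sigma-algebra of \<open>F\<close>, so this
            instance yields measurability of the loss on \<open>F\<close> itself.\<close>
          have "(\<lambda>f. ereal (loss f x)) \<in> borel_measurable q"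
            using learner_expectations[OF q x] by (simp add: expectation_defined_def)
          then have "(\<lambda>f. ereal (loss f x)) \<in> borel_measurable F"
            by (simp add: q_def)
          then have "expectation q (\<lambda>f. ereal (loss f x)) = expectation (measure_pmf ?P) (\<lambda>e. ereal (loss (\<phi> e) x))"
            unfolding q_def by (rule expectation_distr[OF \<phi>_measurable])
          also have "\<dots> = ereal (measure_pmf.expectation ?P (\<lambda>e. loss (\<phi> e) x))"
            by (simp add: expectation_pmf_finite)
          finally have E: "expectation q (\<lambda>f. ereal (loss f x)) = \<dots>" .
          have "?R (xs @ [x]) \<le> ereal (r + \<delta> - measure_pmf.expectation ?P (\<lambda>e. loss (\<phi> e) x))"
            using len F_nonempty \<phi>_le[OF x] by (intro cond_seq_rademacher_le) (auto simp: d_def algebra_simps)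
          then have "ereal (measure_pmf.expectation ?P (\<lambda>e. loss (\<phi> e) x)) + ?R (xs @ [x])
              \<le> ereal (measure_pmf.expectation ?P (\<lambda>e. loss (\<phi> e) x))
                + ereal (r + \<delta> - measure_pmf.expectation ?P (\<lambda>e. loss (\<phi> e) x))"
            by (rule add_left_mono)
          then show "expectation q (\<lambda>f. ereal (loss f x)) + ?R (xs @ [x]) \<le> ereal (r + \<delta>)"
            by (simp add: E)
        qed
        then show "(INF q\<in>space (prob_algebra F). W q) \<le> ereal r + ereal \<delta>"
          using INF_lower2[OF q] by simp
      qed
    qed
  qed
  then show "(INF q\<in>space (prob_algebra F). SUP x\<in>space X. expectation q (\<lambda>f. ereal (loss f x)) + ?R (xs @ [x])) \<le> ?R xs"
    by (simp add: W_def)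
next
  fix xs assume "set xs \<subseteq> space X" and len: "length xs = T"
  \<comment> \<open>At the horizon the depth is 0: every function is a tree, even an undefined one,
    and a constant selection pays minus the past loss.\<close>
  have "ereal (- (\<Sum>x\<leftarrow>xs. loss f x)) \<le> cond_seq_rademacher F X loss T xs" if "f \<in> space F" for f
    using payoff_le_cond_seq_rademacher[of "\<lambda>_ _. undefined" T xs X "\<lambda>_. f" F loss] that len
    by (simp add: payoff_def trees_def)
  then have "(SUP f\<in>space F. - ereal (\<Sum>x\<leftarrow>xs. loss f x)) \<le> cond_seq_rademacher F X loss T xs"
    by (intro SUP_least) simp
  then show "- (INF f\<in>space F. ereal (\<Sum>x\<leftarrow>xs. loss f x)) \<le> cond_seq_rademacher F X loss T xs"
    by (simp only: ereal_SUP_uminus_eq)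
qed

end
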